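(* Let $\mathcal G=\{\mathcal V,\mathcal E\}$ be a simple bi-directed unweighted graph on $\mathcal V=\{1,\dots,m\}$ with a clustering $\mathcal C=\{\mathcal C_1,\dots,\mathcal C_K\}$, and let $\alpha>0$. Suppose that for every $k=1,\dots,K$ one has $\mathcal L_k^i=\mathcal L_k^{i'}$ for all $i,i'\in\mathcal C_k$ (the common inter-cluster coupling condition), where $\mathcal L_k^i=\{k':k'\neq k,\ \mathcal N_{k'}(i)\ne\emptyset\}$ for $i\in\mathcal C_k$. Then there exist positive weights $w_{ij}>0$ (for $e(i,j)\in\mathcal E$) on $\mathcal G$ satisfying $$\sum_{j\in\mathcal N_{k'}(i)}w_{ij}=\sum_{j'\in\mathcal N_{k'}(i')}w_{i'j'}\qquad\text{for all } i,i'\in\mathcal C_k \text{ and all } k\neq k',$$ and a positive definite diagonal matrix $D=\mathrm{diag}[d_1,\dots,d_m]$, with $d=[d_1,\dots,d_m]^\top$, such that $$\big[D(G+\alpha I_m)\big]^{s}\big|_{\mathcal T^{d}_{\mathcal C}(1)}\le 0,$$ if and only if, for each $k=1,\dots,K$, all vertices of the cluster $\mathcal C_k$ belong to the same connected component of $\mathcal G$. Here $G=[g_{ij}]_{i,j=1}^m$ is given by $g_{ij}=w_{ij}$ if $i\ne j$ and $e(i,j)\in\mathcal E$, $g_{ij}=0$ if $i\ne j$ and $e(i,j)\notin\mathcal E$, and $g_{ii}=-\sum_{k\neq i}g_{ik}$.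
   Context: Graph and clustering: "simple" means no self-loops or multiple edges; "bi-directed" means $e(i,j)\in\mathcal E$ if and only if $e(j,i)\in\mathcal E$. The weights need not be symmetric ($w_{ij}$ and $w_{ji}$ may differ). $\mathcal N(i)=\{j\in\mathcal V: e(i,j)\in\mathcal E\}$ is the neighborhood of $i$. A clustering is a partition of $\mathcal V$: $\bigcup_{k=1}^K\mathcal C_k=\mathcal V$ and $\mathcal C_k\cap\mathcal C_l=\emptyset$ for $k\neq l$. $\mathcal N_{k}(i)=\mathcal N(i)\cap\mathcal C_{k}$; empty sums are $0$. A connected component is a maximal set of vertices each of which can reach all the others by paths in $\mathcal G$. Transverse space: $\mathcal T^d_{\mathcal C}(1)=\{u=[u^1,\dots,u^m]^\top\in\mathbb R^m:\ \sum_{i\in\mathcal C_k}d_iu^i=0\ \text{for all }k=1,\dots,K\}$. Matrix notation: $Z^s=(Z+Z^\top)/2$, $I_m$ is the identity matrix, and $Z|_V\le 0$ means $u^\top Zu\le 0$ for all $u$ in the linear subspace $V$. *)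

theory Defs
  imports "HOL-Analysis.Analysis" "Graph_Theory.Graph_Theory"
begin

text \<open>Vertices are the elements of a finite index type \<open>'n\<close> (so \<open>m = CARD('n)\<close>), and a simple
bi-directed graph on them is a \<^locale>\<open>pair_graph\<close> whose vertex set is the whole type.\<close>

definition nbhd :: "'n pair_pre_digraph \<Rightarrow> 'n \<Rightarrow> 'n set" where
  "nbhd G i = {j. (i, j) \<in> parcs G}"

text \<open>The clusters are \<open>C 1, \<dots>, C K\<close>; values of \<open>C\<close> outside \<open>{1..K}\<close> are irrelevant.
As in an indexed partition, an empty \<open>C k\<close> is not excluded.\<close>

definition clustering :: "nat \<Rightarrow> (nat \<Rightarrow> 'n set) \<Rightarrow> bool" where
  "clustering K C \<longleftrightarrow> (\<Union>k\<in>{1..K}. C k) = UNIV \<and> disjoint_family_on C {1..K}"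

text \<open>\<open>cluster_nbhd G C k i\<close> is $\mathcal N_k(i)$, and \<open>coupled_clusters G K C k i\<close> is
$\mathcal L_k^i$, meant for \<open>i \<in> C k\<close>.\<close>

definition cluster_nbhd :: "'n pair_pre_digraph \<Rightarrow> (nat \<Rightarrow> 'n set) \<Rightarrow> nat \<Rightarrow> 'n \<Rightarrow> 'n set" where
  "cluster_nbhd G C k i = nbhd G i \<inter> C k"

definition coupled_clusters ::
    "'n pair_pre_digraph \<Rightarrow> nat \<Rightarrow> (nat \<Rightarrow> 'n set) \<Rightarrow> nat \<Rightarrow> 'n \<Rightarrow> nat set" where
  "coupled_clusters G K C k i = {k' \<in> {1..K}. k' \<noteq> k \<and> cluster_nbhd G C k' i \<noteq> {}}"

definition common_intercluster_coupling ::
    "'n pair_pre_digraph \<Rightarrow> nat \<Rightarrow> (nat \<Rightarrow> 'n set) \<Rightarrow> bool" where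
  "common_intercluster_coupling G K C \<longleftrightarrow>
     (\<forall>k\<in>{1..K}. \<forall>i\<in>C k. \<forall>i'\<in>C k. coupled_clusters G K C k i = coupled_clusters G K C k i')"

text \<open>A weight function is total, but only its values on edges matter.\<close>

definition positive_weights :: "'n pair_pre_digraph \<Rightarrow> ('n \<Rightarrow> 'n \<Rightarrow> real) \<Rightarrow> bool" where
  "positive_weights G w \<longleftrightarrow> (\<forall>(i, j) \<in> parcs G. w i j > 0)"

definition equal_intercluster_sums ::
    "'n pair_pre_digraph \<Rightarrow> nat \<Rightarrow> (nat \<Rightarrow> 'n set) \<Rightarrow> ('n \<Rightarrow> 'n \<Rightarrow> real) \<Rightarrow> bool" where
  "equal_intercluster_sums G K C w \<longleftrightarrow>
     (\<forall>k\<in>{1..K}. \<forall>k'\<in>{1..K}. k \<noteq> k' \<longrightarrow> (\<forall>i\<in>C k. \<forall>i'\<in>C k.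
        (\<Sum>j\<in>cluster_nbhd G C k' i. w i j) = (\<Sum>j'\<in>cluster_nbhd G C k' i'. w i' j')))"

definition offdiag_coupling ::
    "'n pair_pre_digraph \<Rightarrow> ('n \<Rightarrow> 'n \<Rightarrow> real) \<Rightarrow> 'n \<Rightarrow> 'n \<Rightarrow> real" where
  "offdiag_coupling G w i j = (if (i, j) \<in> parcs G then w i j else 0)"

definition coupling_matrix ::
    "'n::finite pair_pre_digraph \<Rightarrow> ('n \<Rightarrow> 'n \<Rightarrow> real) \<Rightarrow> real^'n^'n" where
  "coupling_matrix G w =
     (\<chi> i j. if i = j then - (\<Sum>k\<in>UNIV - {i}. offdiag_coupling G w i k)
             else offdiag_coupling G w i j)"

definition diag_matrix :: "real^'n::finite \<Rightarrow> real^'n^'n" where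
  "diag_matrix d = (\<chi> i j. if i = j then d $ i else 0)"

definition positive_definite :: "real^'n::finite^'n \<Rightarrow> bool" where
  "positive_definite A \<longleftrightarrow> transpose A = A \<and> (\<forall>x. x \<noteq> 0 \<longrightarrow> x \<bullet> (A *v x) > 0)"

definition sym_part :: "real^'n::finite^'n \<Rightarrow> real^'n^'n" where
  "sym_part Z = (1/2) *\<^sub>R (Z + transpose Z)"

definition nonpos_on :: "real^'n::finite^'n \<Rightarrow> (real^'n) set \<Rightarrow> bool" where
  "nonpos_on Z V \<longleftrightarrow> (\<forall>u\<in>V. u \<bullet> (Z *v u) \<le> 0)"

definition transverse_space ::
    "nat \<Rightarrow> (nat \<Rightarrow> 'n set) \<Rightarrow> real^'n::finite \<Rightarrow> (real^'n) set" where
  "transverse_space K C d = {u. \<forall>k\<in>{1..K}. (\<Sum>i\<in>C k. d $ i * u $ i) = 0}"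

end

theory Submission
  imports Defs
begin

text \<open>Write \<open>(u, v)\<^sub>d = (\<Sum>i. d i * u i * v i)\<close>, so that the transverse space is the
\<open>d\<close>-orthogonal complement of the cluster-constant vectors and the form in question is
\<open>(u, (G + \<alpha>) u)\<^sub>d\<close>.

Suppose that suitable \<open>w\<close> and \<open>d\<close> exist and that a component \<open>S\<close> of the graph splits some cluster.
Take for \<open>u\<close> the \<open>d\<close>-orthogonal projection of the indicator of \<open>S\<close> to the transverse space, that is,
the indicator minus its weighted cluster averages (\<open>cluster_average_transverse\<close>). The coupling
matrix \<open>G\<close> kills the indicator, since no edge leaves \<open>S\<close>, and it maps the averages to a
cluster-constant vector, since the inter-cluster sums are equal
(\<open>coupling_preserves_cluster_constant\<close>). Hence \<open>(u, G u)\<^sub>d = 0\<close>, while \<open>\<alpha> * (u, u)\<^sub>d > 0\<close>: the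
form takes a positive value on the transverse space.

Conversely, suppose that no component splits a cluster. Spread a unit weight evenly over the
neighbours of a vertex in each single cluster; by the common coupling condition the inter-cluster
sums agree. Weights with equal sums that make \<open>D G\<close> symmetric need not exist, but it suffices
that \<open>d\<close> is a positive left null vector of \<open>G\<close>, a stationary distribution
(\<open>positive_stationary_vector\<close>). Then \<open>(u, G u)\<^sub>d\<close> is minus the Dirichlet energy
\<open>1/2 * (\<Sum>i j. d i * w i j * (u i - u j)\<^sup>2)\<close> (\<open>stationary_energy\<close>), which vanishes only if \<open>u\<close> is
constant on components; a transverse \<open>u\<close> of this kind is constant on every cluster with mean zero,
so it is \<open>0\<close>. By compactness the energy dominates \<open>(u, u)\<^sub>d\<close> up to a factor
(\<open>positive_form_dominates_norm\<close>). Multiplying all weights by a large constant affects neither \<open>d\<close>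
nor the equality of the inter-cluster sums, and makes the energy outweigh \<open>\<alpha> * (u, u)\<^sub>d\<close>.\<close>

section \<open>The quadratic form in coordinates\<close>

lemma coupling_matrix_mult_vector:
  "(coupling_matrix G w *v u) $ i = (\<Sum>j\<in>UNIV. offdiag_coupling G w i j * (u $ j - u $ i))"
proof -
  have "(\<Sum>j\<in>UNIV. offdiag_coupling G w i j * (u $ j - u $ i))
      = (\<Sum>j\<in>UNIV - {i}. offdiag_coupling G w i j * (u $ j - u $ i))"
    by (rule sum.mono_neutral_right) auto
  also have "\<dots> = (\<Sum>j\<in>UNIV - {i}. offdiag_coupling G w i j * u $ j)
      - (\<Sum>j\<in>UNIV - {i}. offdiag_coupling G w i j) * u $ i"
    by (simp add: right_diff_distrib sum_subtractf sum_distrib_right)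
  also have "\<dots> = (coupling_matrix G w *v u) $ i"
    unfolding matrix_vector_mult_def coupling_matrix_def
    by (simp add: sum.remove[of UNIV i])
  finally show ?thesis by simp
qed

lemma diag_matrix_mult_vector: "(diag_matrix d *v x) $ i = d $ i * x $ i"
  unfolding matrix_vector_mult_def diag_matrix_def
  by (simp add: if_distrib if_distribR sum.delta cong: if_cong)

lemma sym_part_form: "u \<bullet> (sym_part Z *v u) = u \<bullet> (Z *v u)"
proof -
  have "u \<bullet> (transpose Z *v u) = u \<bullet> (Z *v u)"
    by (metis dot_lmul_matrix inner_commute transpose_matrix_vector)
  then show ?thesis
    by (simp add: sym_part_def scaleR_matrix_vector_assoc[symmetric] matrix_vector_mult_add_rdistrib
        inner_add_right)
qed

lemma weighted_form:
  "u \<bullet> (sym_part (diag_matrix d ** (A + \<alpha> *\<^sub>R mat 1)) *v u)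
     = (\<Sum>i\<in>UNIV. d $ i * u $ i * (A *v u) $ i) + \<alpha> * (\<Sum>i\<in>UNIV. d $ i * (u $ i)\<^sup>2)"
proof -
  have "u \<bullet> (sym_part (diag_matrix d ** (A + \<alpha> *\<^sub>R mat 1)) *v u)
      = u \<bullet> (diag_matrix d *v (A *v u + \<alpha> *\<^sub>R u))"
    by (simp add: sym_part_form matrix_vector_mul_assoc[symmetric] matrix_vector_mult_add_rdistrib
        scaleR_matrix_vector_assoc[symmetric])
  also have "\<dots> = (\<Sum>i\<in>UNIV. d $ i * u $ i * (A *v u) $ i + \<alpha> * (d $ i * (u $ i)\<^sup>2))"
    unfolding inner_vec_def
    by (intro sum.cong) (auto simp: diag_matrix_mult_vector power2_eq_square algebra_simps)
  finally show ?thesis by (simp add: sum.distrib sum_distrib_left)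
qed

lemma positive_definite_diag_iff: "positive_definite (diag_matrix d) \<longleftrightarrow> (\<forall>i. d $ i > 0)"
proof
  assume "positive_definite (diag_matrix d)"
  then have "axis i 1 \<bullet> (diag_matrix d *v axis i 1) > 0" for i
    by (auto simp: positive_definite_def)
  then show "\<forall>i. d $ i > 0"
    by (simp add: inner_axis' diag_matrix_mult_vector)
next
  assume d: "\<forall>i. d $ i > 0"
  have "x \<bullet> (diag_matrix d *v x) > 0" if x: "x \<noteq> 0" for x
  proof -
    have "x \<bullet> (diag_matrix d *v x) = (\<Sum>i\<in>UNIV. d $ i * (x $ i)\<^sup>2)"
      unfolding inner_vec_def
      by (intro sum.cong) (auto simp: diag_matrix_mult_vector power2_eq_square)
    moreover obtain i where "x $ i \<noteq> 0" using x by (auto simp: vec_eq_iff)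
    then have "(\<Sum>i\<in>UNIV. d $ i * (x $ i)\<^sup>2) > 0"
      using d by (intro sum_pos2[of _ i]) (auto simp: less_imp_le)
    ultimately show ?thesis by simp
  qed
  moreover have "transpose (diag_matrix d) = diag_matrix d"
    by (auto simp: transpose_def diag_matrix_def vec_eq_iff)
  ultimately show "positive_definite (diag_matrix d)" by (simp add: positive_definite_def)
qed

section \<open>Connected components and clusterings\<close>

lemma sym_arcs: "pair_graph G \<Longrightarrow> sym (parcs G)"
  using pair_sym_digraph.pair_sym_arcs[of G]
  by (auto simp: pair_graph_def pair_pseudo_graph_def symmetric_def)

lemma within_scc_iff:
  fixes G :: "'n pair_pre_digraph"
  assumes "pverts G = UNIV" and "sym (parcs G)"
  shows "(\<exists>S\<in>pre_digraph.sccs_verts (with_proj G). A \<subseteq> S)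
     \<longleftrightarrow> (\<forall>i\<in>A. \<forall>j\<in>A. (i, j) \<in> (parcs G)\<^sup>*)"
proof -
  have reach: "i \<rightarrow>\<^sup>*\<^bsub>with_proj G\<^esub> j \<longleftrightarrow> (i, j) \<in> (parcs G)\<^sup>*" for i j
  proof
    show "(i, j) \<in> (parcs G)\<^sup>*" if "i \<rightarrow>\<^sup>*\<^bsub>with_proj G\<^esub> j"
      using reachable_rtranclI[OF that] by simp
    show "i \<rightarrow>\<^sup>*\<^bsub>with_proj G\<^esub> j" if "(i, j) \<in> (parcs G)\<^sup>*"
      using that
    proof (induction rule: rtrancl_induct)
      case base
      show ?case using assms(1) by (simp add: reachable_def)
    next
      case (step y z)
      then show ?case
        using assms(1) rtrancl_on_into_rtrancl_on[of i y UNIV "parcs G" z]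
        by (simp add: reachable_def)
    qed
  qed
  have sym: "(j, i) \<in> (parcs G)\<^sup>*" if "(i, j) \<in> (parcs G)\<^sup>*" for i j
    using that assms(2) by (meson sym_rtrancl symD)
  have component: "(parcs G)\<^sup>* `` {i} \<in> pre_digraph.sccs_verts (with_proj G)" for i
    unfolding pre_digraph.sccs_verts_def reach by (auto intro: rtrancl_trans sym)
  show ?thesis
  proof
    assume "\<exists>S\<in>pre_digraph.sccs_verts (with_proj G). A \<subseteq> S"
    then show "\<forall>i\<in>A. \<forall>j\<in>A. (i, j) \<in> (parcs G)\<^sup>*"
      unfolding pre_digraph.sccs_verts_def reach by blast
  next
    assume conn: "\<forall>i\<in>A. \<forall>j\<in>A. (i, j) \<in> (parcs G)\<^sup>*"
    \<comment> \<open>The base vertex is arbitrary if \<open>A\<close> is empty.\<close>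
    obtain i where "A \<noteq> {} \<longrightarrow> i \<in> A" by blast
    with conn have "A \<subseteq> (parcs G)\<^sup>* `` {i}" by auto
    with component show "\<exists>S\<in>pre_digraph.sccs_verts (with_proj G). A \<subseteq> S" by blast
  qed
qed

lemma clustering_index:
  assumes "clustering K C"
  obtains c where "\<And>i. c i \<in> {1..K}" and "\<And>i. i \<in> C (c i)"
    and "\<And>i k. k \<in> {1..K} \<Longrightarrow> i \<in> C k \<Longrightarrow> c i = k"
proof -
  have "\<forall>i. \<exists>k. k \<in> {1..K} \<and> i \<in> C k"
    using assms unfolding clustering_def by blast
  then obtain c where c: "\<And>i. c i \<in> {1..K} \<and> i \<in> C (c i)" by metis
  moreover have "c i = k" if "k \<in> {1..K}" "i \<in> C k" for i k
    using assms c[of i] that unfolding clustering_def disjoint_family_on_def by blast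
  ultimately show thesis using that by blast
qed

lemma sum_over_clusters:
  fixes f :: "'n::finite \<Rightarrow> real"
  assumes "clustering K C"
  shows "sum f UNIV = (\<Sum>k\<in>{1..K}. sum f (C k))"
proof -
  have "sum f (\<Union>k\<in>{1..K}. C k) = (\<Sum>k\<in>{1..K}. sum f (C k))"
    using assms by (intro sum.UNION_disjoint)
      (auto simp: clustering_def disjoint_family_on_def)
  then show ?thesis using assms by (simp add: clustering_def)
qed

definition cluster_constant :: "nat \<Rightarrow> (nat \<Rightarrow> 'n set) \<Rightarrow> ('n \<Rightarrow> real) \<Rightarrow> bool" where
  "cluster_constant K C f \<longleftrightarrow> (\<forall>k\<in>{1..K}. \<forall>i\<in>C k. \<forall>i'\<in>C k. f i = f i')"

lemma transverse_orthogonal_cluster_constant: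
  fixes u d :: "real^'n::finite"
  assumes "clustering K C" and u: "u \<in> transverse_space K C d" and f: "cluster_constant K C f"
  shows "(\<Sum>i\<in>UNIV. d $ i * u $ i * f i) = 0"
proof -
  have "(\<Sum>i\<in>C k. d $ i * u $ i * f i) = 0" if k: "k \<in> {1..K}" for k
  proof (cases "C k = {}")
    case False
    then obtain i0 where "i0 \<in> C k" by blast
    then have "f i = f i0" if "i \<in> C k" for i
      using f k that unfolding cluster_constant_def by blast
    then have "(\<Sum>i\<in>C k. d $ i * u $ i * f i) = (\<Sum>i\<in>C k. d $ i * u $ i) * f i0"
      by (simp add: sum_distrib_right)
    then show ?thesis using u k by (simp add: transverse_space_def)
  qed simp
  then show ?thesis by (simp add: sum_over_clusters[OF assms(1)])
qed

section \<open>A split cluster makes the form indefinite\<close>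

lemma sum_offdiag_coupling_cluster:
  fixes G :: "'n::finite pair_pre_digraph"
  shows "(\<Sum>j\<in>C l. offdiag_coupling G w i j) = (\<Sum>j\<in>cluster_nbhd G C l i. w i j)"
proof -
  have "(\<Sum>j\<in>C l. offdiag_coupling G w i j) = (\<Sum>j\<in>cluster_nbhd G C l i. offdiag_coupling G w i j)"
    by (rule sum.mono_neutral_right)
      (auto simp: cluster_nbhd_def nbhd_def offdiag_coupling_def)
  also have "\<dots> = (\<Sum>j\<in>cluster_nbhd G C l i. w i j)"
    by (rule sum.cong) (auto simp: cluster_nbhd_def nbhd_def offdiag_coupling_def)
  finally show ?thesis .
qed

text \<open>The row sum of \<open>G\<close> at \<open>i\<close> over a foreign cluster depends only on the cluster of \<open>i\<close>, and
inside its own cluster \<open>i\<close> sees no differences of \<open>p\<close>.\<close>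

lemma coupling_preserves_cluster_constant:
  fixes G :: "'n::finite pair_pre_digraph"
  assumes cl: "clustering K C" and eq: "equal_intercluster_sums G K C w"
    and p: "cluster_constant K C (($) p)"
  shows "cluster_constant K C (($) (coupling_matrix G w *v p))"
  unfolding cluster_constant_def
proof (intro ballI)
  fix k i i' assume k: "k \<in> {1..K}" and i: "i \<in> C k" and i': "i' \<in> C k"
  let ?row = "\<lambda>i l. \<Sum>j\<in>C l. offdiag_coupling G w i j * (p $ j - p $ i)"
  have "?row i l = ?row i' l" if l: "l \<in> {1..K}" for l
  proof (cases "C l = {}")
    case False
    then obtain j0 where "j0 \<in> C l" by blast
    then have pj: "p $ j = p $ j0" if "j \<in> C l" for j
      using p l that unfolding cluster_constant_def by blast
    have pi: "p $ i = p $ i'" using p k i i' unfolding cluster_constant_def by blast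
    have row: "?row h l = (\<Sum>j\<in>cluster_nbhd G C l h. w h j) * (p $ j0 - p $ h)" for h
      using pj by (simp add: sum_offdiag_coupling_cluster[symmetric] sum_distrib_right)
    show ?thesis
    proof (cases "l = k")
      case True
      then have "p $ j0 = p $ i" "p $ j0 = p $ i'" using pj[of i] i pi by simp_all
      then have "?row i l = 0" "?row i' l = 0" unfolding row by simp_all
      then show ?thesis by simp
    next
      case False
      then have "(\<Sum>j\<in>cluster_nbhd G C l i. w i j) = (\<Sum>j\<in>cluster_nbhd G C l i'. w i' j)"
        using eq[unfolded equal_intercluster_sums_def, rule_format, OF k l _ i i'] by simp
      then show ?thesis unfolding row by (simp add: pi)
    qed
  qed simp
  then show "(coupling_matrix G w *v p) $ i = (coupling_matrix G w *v p) $ i'"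
    by (simp add: coupling_matrix_mult_vector sum_over_clusters[OF cl])
qed

lemma cluster_average_transverse:
  fixes x d :: "real^'n::finite"
  assumes cl: "clustering K C" and d: "\<And>i. d $ i > 0"
  obtains p where "cluster_constant K C (($) p)" and "x - p \<in> transverse_space K C d"
proof -
  obtain c where c: "\<And>i k. k \<in> {1..K} \<Longrightarrow> i \<in> C k \<Longrightarrow> c i = k"
    using clustering_index[OF cl] by metis
  define avg where "avg k = (\<Sum>j\<in>C k. d $ j * x $ j) / (\<Sum>j\<in>C k. d $ j)" for k
  define p :: "real^'n" where "p = (\<chi> i. avg (c i))"
  have "(\<Sum>i\<in>C k. d $ i * (x - p) $ i) = 0" if k: "k \<in> {1..K}" for k
  proof (cases "C k = {}")
    case False
    then have "(\<Sum>j\<in>C k. d $ j) > 0" using d by (intro sum_pos) auto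
    moreover have "(\<Sum>i\<in>C k. d $ i * (x - p) $ i)
        = (\<Sum>i\<in>C k. d $ i * x $ i) - (\<Sum>i\<in>C k. d $ i) * avg k"
      using c[OF k] by (simp add: p_def right_diff_distrib sum_subtractf sum_distrib_right)
    ultimately show ?thesis by (simp add: avg_def)
  qed simp
  then have "x - p \<in> transverse_space K C d" by (simp add: transverse_space_def)
  moreover have "cluster_constant K C (($) p)"
    unfolding cluster_constant_def using c by (auto simp: p_def)
  ultimately show thesis using that by blast
qed

lemma nonpos_imp_component_respects_clusters:
  fixes G :: "'n::finite pair_pre_digraph"
  assumes cl: "clustering K C" and eq: "equal_intercluster_sums G K C w"
    and d: "\<And>i. d $ i > 0" and \<alpha>: "\<alpha> > 0"
    and nonpos: "nonpos_on (sym_part (diag_matrix d ** (coupling_matrix G w + \<alpha> *\<^sub>R mat 1)))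
              (transverse_space K C d)"
    and closed: "\<And>i j. (i, j) \<in> parcs G \<Longrightarrow> i \<in> S \<longleftrightarrow> j \<in> S"
    and k: "k \<in> {1..K}" and i: "i \<in> C k" and j: "j \<in> C k" and iS: "i \<in> S"
  shows "j \<in> S"
proof (rule ccontr)
  assume jS: "j \<notin> S"
  let ?M = "coupling_matrix G w"
  define x :: "real^'n" where "x = (\<chi> i. if i \<in> S then 1 else 0)"
  obtain p where p: "cluster_constant K C (($) p)" and u: "x - p \<in> transverse_space K C d"
    using cluster_average_transverse[OF cl d] .
  define u where "u = x - p"
  have "?M *v x = 0"
    unfolding vec_eq_iff coupling_matrix_mult_vector
    by (auto intro!: sum.neutral simp: x_def offdiag_coupling_def closed)
  then have Mu: "?M *v u = - (?M *v p)"
    by (simp add: u_def matrix_vector_mult_diff_distrib)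
  have "(\<Sum>i\<in>UNIV. d $ i * u $ i * (?M *v u) $ i) = 0"
    using transverse_orthogonal_cluster_constant[OF cl u
        coupling_preserves_cluster_constant[OF cl eq p]]
    by (simp add: Mu u_def[symmetric] sum_negf)
  moreover have "u \<bullet> (sym_part (diag_matrix d ** (?M + \<alpha> *\<^sub>R mat 1)) *v u) \<le> 0"
    using nonpos u by (simp add: nonpos_on_def u_def)
  ultimately have "\<alpha> * (\<Sum>i\<in>UNIV. d $ i * (u $ i)\<^sup>2) \<le> 0"
    by (simp add: weighted_form)
  then have "\<not> (\<Sum>i\<in>UNIV. d $ i * (u $ i)\<^sup>2) > 0"
    using \<alpha> by (simp add: mult_le_0_iff)
  moreover have "(\<Sum>i\<in>UNIV. d $ i * (u $ i)\<^sup>2) > 0" if "u $ h \<noteq> 0" for h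
    using d that by (intro sum_pos2[of _ h]) (auto simp: less_imp_le)
  ultimately have "u $ h = 0" for h by blast
  then have "x $ i = p $ i" "x $ j = p $ j" by (simp_all add: u_def)
  moreover have "p $ i = p $ j" using p k i j unfolding cluster_constant_def by blast
  ultimately have "x $ i = x $ j" by metis
  then show False using iS jS by (simp add: x_def)
qed

section \<open>Stationary vectors and the Dirichlet energy\<close>

text \<open>Existence is Brouwer's theorem for one step of a lazy random walk with rates proportional to
\<open>a\<close>. Fixing the mass of each component, not only the total mass, prevents the fixed point from
vanishing on some component; as mass spreads along edges, it is then positive everywhere.\<close>

lemma positive_stationary_vector:
  fixes a :: "'n::finite \<Rightarrow> 'n \<Rightarrow> real"
  assumes a: "\<And>i j. a i j \<ge> 0" and sym: "\<And>i j. a i j > 0 \<Longrightarrow> a j i > 0"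
  obtains d :: "real^'n" where "\<And>i. d $ i > 0"
    and "\<And>j. (\<Sum>i\<in>UNIV. d $ i * a i j) = d $ j * (\<Sum>i\<in>UNIV. a j i)"
proof -
  define R where "R = {(i, j). a i j > 0}"
  define comp where "comp i = R\<^sup>* `` {i}" for i
  have "sym R" using sym by (auto simp: R_def intro: symI)
  then have symR: "(j, i) \<in> R\<^sup>*" if "(i, j) \<in> R\<^sup>*" for i j
    using that by (meson sym_rtrancl symD)
  have comp_self: "i \<in> comp i" for i by (simp add: comp_def)
  have comp_eq: "comp j = comp i" if "j \<in> comp i" for i j
    using that symR unfolding comp_def by (auto intro: rtrancl_trans)
  have edge_in_comp: "i \<in> comp k \<longleftrightarrow> j \<in> comp k" if "a i j > 0" for i j k
  proof -
    have "(i, j) \<in> R" "(j, i) \<in> R" using that sym by (auto simp: R_def)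
    then show ?thesis unfolding comp_def by (auto intro: rtrancl_into_rtrancl)
  qed
  define r where "r i = (\<Sum>j\<in>UNIV. a i j)" for i
  have r0: "r i \<ge> 0" for i using a by (auto simp: r_def intro: sum_nonneg)
  define s where "s = 1 + (\<Sum>i\<in>UNIV. r i)"
  have s: "s > 0" "r i \<le> s" for i
  proof -
    have "r i \<le> (\<Sum>i\<in>UNIV. r i)" using r0 by (intro member_le_sum) auto
    then show "r i \<le> s" by (simp add: s_def)
    show "s > 0" using r0 by (simp add: s_def add_pos_nonneg sum_nonneg)
  qed
  define f :: "real^'n \<Rightarrow> real^'n" where
    "f x = (\<chi> j. x $ j + ((\<Sum>i\<in>UNIV. x $ i * a i j) - x $ j * r j) / s)" for x
  define X where "X = {x :: real^'n. (\<forall>i. 0 \<le> x $ i) \<and> (\<forall>i. (\<Sum>j\<in>comp i. x $ j) = 1)}"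
  have "compact X"
    unfolding compact_eq_bounded_closed
  proof
    have "norm x \<le> CARD('n)" if "x \<in> X" for x
    proof -
      have "\<bar>x $ i\<bar> \<le> 1" for i
      proof -
        have "x $ i \<le> (\<Sum>j\<in>comp i. x $ j)"
          using that comp_self by (intro member_le_sum) (auto simp: X_def)
        then show ?thesis using that by (simp add: X_def)
      qed
      then have "(\<Sum>i\<in>UNIV. \<bar>x $ i\<bar>) \<le> (\<Sum>i\<in>(UNIV :: 'n set). 1)" by (intro sum_mono) auto
      then show ?thesis using norm_le_l1_cart[of x] by simp
    qed
    then show "bounded X" by (auto simp: bounded_iff)
    have "X = (\<Inter>i. {x. 0 \<le> x $ i}) \<inter> (\<Inter>i. {x. (\<Sum>j\<in>comp i. x $ j) = 1})"
      by (auto simp: X_def)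
    also have "closed \<dots>"
      by (intro closed_Int closed_INT ballI closed_Collect_le closed_Collect_eq continuous_intros)
    finally show "closed X" .
  qed
  moreover have "convex X"
    unfolding convex_def X_def
    by (auto simp: sum.distrib sum_distrib_left[symmetric])
  moreover have "(\<chi> i. 1 / card (comp i)) \<in> X"
  proof -
    have "(\<Sum>j\<in>comp i. 1 / card (comp j)) = (1 :: real)" for i
    proof -
      have "(\<Sum>j\<in>comp i. 1 / card (comp j)) = (\<Sum>j\<in>comp i. 1 / real (card (comp i)))"
        using comp_eq by (intro sum.cong) auto
      also have "\<dots> = 1" using comp_self[of i] by (auto simp: card_eq_0_iff)
      finally show ?thesis .
    qed
    then show ?thesis by (simp add: X_def)
  qed
  moreover have "continuous_on X f"
    unfolding f_def using s by (auto intro!: continuous_intros)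
  moreover have "f \<in> X \<rightarrow> X"
  proof
    fix x assume x: "x \<in> X"
    have "f x $ j \<ge> 0" for j
    proof -
      have "x $ j * r j \<le> x $ j * s" using x s by (intro mult_left_mono) (auto simp: X_def)
      moreover have "(\<Sum>i\<in>UNIV. x $ i * a i j) \<ge> 0"
        using x a by (auto simp: X_def intro!: sum_nonneg)
      ultimately have "0 \<le> (x $ j * s + ((\<Sum>i\<in>UNIV. x $ i * a i j) - x $ j * r j)) / s"
        using s by (intro divide_nonneg_pos) auto
      also have "\<dots> = f x $ j" using s by (simp add: f_def add_divide_distrib)
      finally show ?thesis .
    qed
    moreover have "(\<Sum>j\<in>comp k. f x $ j) = 1" for k
    proof -
      have "(\<Sum>j\<in>comp k. \<Sum>i\<in>UNIV. x $ i * a i j) = (\<Sum>i\<in>UNIV. x $ i * (\<Sum>j\<in>comp k. a i j))"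
        by (subst sum.swap) (simp add: sum_distrib_left)
      also have "\<dots> = (\<Sum>i\<in>UNIV. if i \<in> comp k then x $ i * r i else 0)"
      proof (rule sum.cong)
        fix i
        have "a i j = 0" if "(i \<in> comp k) \<noteq> (j \<in> comp k)" for j
          using edge_in_comp[of i j k] a[of i j] that by force
        then have "(\<Sum>j\<in>comp k. a i j) = (if i \<in> comp k then r i else 0)"
          unfolding r_def by (auto intro: sum.neutral sum.mono_neutral_left)
        then show "x $ i * (\<Sum>j\<in>comp k. a i j) = (if i \<in> comp k then x $ i * r i else 0)"
          by simp
      qed simp
      also have "\<dots> = (\<Sum>j\<in>comp k. x $ j * r j)"
        by (simp add: sum.If_cases)
      finally have "(\<Sum>j\<in>comp k. (\<Sum>i\<in>UNIV. x $ i * a i j) - x $ j * r j) = 0"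
        by (simp add: sum_subtractf)
      then show ?thesis
        using x by (simp add: f_def X_def sum.distrib sum_divide_distrib[symmetric])
    qed
    ultimately show "f x \<in> X" by (simp add: X_def)
  qed
  ultimately obtain d where d: "d \<in> X" "f d = d"
    using brouwer[of X f] by blast
  have stationary: "(\<Sum>i\<in>UNIV. d $ i * a i j) = d $ j * r j" for j
  proof -
    have "f d $ j = d $ j" using d by simp
    then show ?thesis using s by (simp add: f_def)
  qed
  have spread: "d $ j > 0" if "d $ i > 0" "(i, j) \<in> R\<^sup>*" for i j
    using that(2,1)
  proof (induction rule: rtrancl_induct)
    case (step y z)
    then have "0 < d $ y * a y z" by (simp add: R_def)
    also have "\<dots> \<le> (\<Sum>i\<in>UNIV. d $ i * a i z)"
      using d a by (intro member_le_sum) (auto simp: X_def)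
    finally have "d $ z \<noteq> 0" by (auto simp: stationary)
    then show ?case using d by (simp add: X_def less_le)
  qed
  have "d $ i > 0" for i
  proof -
    have "(\<Sum>j\<in>comp i. d $ j) \<noteq> 0" using d by (simp add: X_def)
    then obtain j where "j \<in> comp i" "d $ j \<noteq> 0" by (meson sum.neutral)
    then show ?thesis using d spread[of j i] symR by (auto simp: X_def comp_def less_le)
  qed
  then show thesis by (rule that[OF _ stationary[unfolded r_def]])
qed

text \<open>Stationarity says that the measure \<open>d i * a i j\<close> on pairs has equal marginals, so the diagonal
terms \<open>(u i)\<^sup>2\<close> and \<open>(u j)\<^sup>2\<close> contribute equally.\<close>

lemma stationary_energy:
  fixes u d :: "real^'n::finite"
  assumes "\<And>j. (\<Sum>i\<in>UNIV. d $ i * a i j) = d $ j * (\<Sum>i\<in>UNIV. a j i)"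
  shows "(\<Sum>i\<in>UNIV. d $ i * u $ i * (\<Sum>j\<in>UNIV. a i j * (u $ j - u $ i)))
     = - (1/2) * (\<Sum>i\<in>UNIV. \<Sum>j\<in>UNIV. d $ i * a i j * (u $ i - u $ j)\<^sup>2)"
proof -
  let ?q = "\<lambda>i j. d $ i * a i j"
  have "(\<Sum>i\<in>UNIV. \<Sum>j\<in>UNIV. ?q i j * (u $ j)\<^sup>2) = (\<Sum>j\<in>UNIV. (\<Sum>i\<in>UNIV. ?q i j) * (u $ j)\<^sup>2)"
    by (subst sum.swap) (simp add: sum_distrib_right)
  also have "\<dots> = (\<Sum>i\<in>UNIV. \<Sum>j\<in>UNIV. ?q i j * (u $ i)\<^sup>2)"
    by (simp add: assms sum_distrib_left sum_distrib_right)
  finally have marginals: "(\<Sum>i\<in>UNIV. \<Sum>j\<in>UNIV. ?q i j * (u $ j)\<^sup>2)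
      = (\<Sum>i\<in>UNIV. \<Sum>j\<in>UNIV. ?q i j * (u $ i)\<^sup>2)" .
  have "(\<Sum>i\<in>UNIV. d $ i * u $ i * (\<Sum>j\<in>UNIV. a i j * (u $ j - u $ i)))
      = (\<Sum>i\<in>UNIV. \<Sum>j\<in>UNIV. - (1/2) * (?q i j * (u $ i - u $ j)\<^sup>2)
          + (1/2) * (?q i j * (u $ j)\<^sup>2) - (1/2) * (?q i j * (u $ i)\<^sup>2))"
    by (auto simp: sum_distrib_left power2_eq_square field_simps intro!: sum.cong)
  also have "\<dots> = - (1/2) * (\<Sum>i\<in>UNIV. \<Sum>j\<in>UNIV. ?q i j * (u $ i - u $ j)\<^sup>2)"
    using marginals by (simp only: sum.distrib sum_subtractf sum_distrib_left[symmetric])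
  finally show ?thesis .
qed

lemma positive_form_dominates_norm:
  fixes q :: "'a::euclidean_space \<Rightarrow> real"
  assumes V: "subspace V" and cont: "continuous_on UNIV q"
    and hom: "\<And>c x. q (c *\<^sub>R x) = c\<^sup>2 * q x"
    and pos: "\<And>x. x \<in> V \<Longrightarrow> x \<noteq> 0 \<Longrightarrow> q x > 0"
  obtains t where "t > 0" and "\<And>x. x \<in> V \<Longrightarrow> (norm x)\<^sup>2 \<le> t * q x"
proof (cases "V \<subseteq> {0}")
  case True
  then have "(norm x)\<^sup>2 \<le> 1 * q x" if "x \<in> V" for x
    using that hom[of 0 0] by auto
  then show ?thesis using that[of 1] by simp
next
  case False
  let ?S = "V \<inter> sphere 0 1"
  obtain y where y: "y \<in> V" "y \<noteq> 0" using False by blast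
  have "(1 / norm y) *\<^sub>R y \<in> ?S" using y V by (auto intro: subspace_scale)
  moreover have "compact ?S"
    using V by (intro closed_Int_compact closed_subspace) auto
  ultimately obtain z where z: "z \<in> ?S" "\<And>x. x \<in> ?S \<Longrightarrow> q z \<le> q x"
    using continuous_attains_inf[of ?S q] continuous_on_subset[OF cont] by blast
  have qz: "q z > 0" using z(1) by (intro pos) auto
  have "(norm x)\<^sup>2 \<le> (1 / q z) * q x" if x: "x \<in> V" for x
  proof (cases "x = 0")
    case True
    then show ?thesis using hom[of 0 0] by simp
  next
    case False
    have "q z \<le> q ((1 / norm x) *\<^sub>R x)" using x V False by (intro z) (auto intro: subspace_scale)
    then have "q z \<le> (1 / norm x)\<^sup>2 * q x" by (simp only: hom)
    then show ?thesis using False qz by (simp add: field_simps)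
  qed
  then show ?thesis using that[of "1 / q z"] qz by simp
qed

section \<open>Weights for unsplit clusters\<close>

lemma unit_cluster_weights:
  fixes G :: "'n::finite pair_pre_digraph"
  assumes cl: "clustering K C" and common: "common_intercluster_coupling G K C"
  obtains w where "positive_weights G w" and "equal_intercluster_sums G K C w"
proof -
  obtain c where c: "\<And>i. i \<in> C (c i)" "\<And>i k. k \<in> {1..K} \<Longrightarrow> i \<in> C k \<Longrightarrow> c i = k"
    using clustering_index[OF cl] by metis
  define w where "w i j = 1 / real (card (cluster_nbhd G C (c j) i))" for i j
  have "positive_weights G w"
    using c(1) by (auto simp: positive_weights_def w_def card_gt_0_iff cluster_nbhd_def nbhd_def)
  moreover have "equal_intercluster_sums G K C w"
    unfolding equal_intercluster_sums_def
  proof (intro ballI impI)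
    fix k l i i' assume *: "k \<in> {1..K}" "l \<in> {1..K}" "k \<noteq> l" "i \<in> C k" "i' \<in> C k"
    have unit: "(\<Sum>j\<in>cluster_nbhd G C l h. w h j) = (if cluster_nbhd G C l h = {} then 0 else 1)"
      for h
    proof -
      have "(\<Sum>j\<in>cluster_nbhd G C l h. w h j)
          = (\<Sum>j\<in>cluster_nbhd G C l h. 1 / real (card (cluster_nbhd G C l h)))"
        using c(2) * by (intro sum.cong) (auto simp: w_def cluster_nbhd_def)
      then show ?thesis by simp
    qed
    have "coupled_clusters G K C k i = coupled_clusters G K C k i'"
      using common * unfolding common_intercluster_coupling_def by blast
    then have "cluster_nbhd G C l i = {} \<longleftrightarrow> cluster_nbhd G C l i' = {}"
      using * unfolding coupled_clusters_def by blast
    then show "(\<Sum>j\<in>cluster_nbhd G C l i. w i j) = (\<Sum>j\<in>cluster_nbhd G C l i'. w i' j)"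
      by (simp add: unit)
  qed
  ultimately show thesis using that by blast
qed

lemma subspace_transverse_space:
  fixes d :: "real^'n::finite"
  shows "subspace (transverse_space K C d)"
  unfolding transverse_space_def
  by (auto simp: subspace_def sum.distrib distrib_left sum_distrib_left[symmetric]
      mult.left_commute)

lemma transverse_constant_on_components_zero:
  fixes u d :: "real^'n::finite"
  assumes cl: "clustering K C" and d: "\<And>i. d $ i > 0"
    and conn: "\<forall>k\<in>{1..K}. \<forall>i\<in>C k. \<forall>j\<in>C k. (i, j) \<in> E\<^sup>*"
    and u: "u \<in> transverse_space K C d" and const: "\<And>i j. (i, j) \<in> E \<Longrightarrow> u $ i = u $ j"
  shows "u = 0"
proof -
  have "u $ i = u $ j" if "(i, j) \<in> E\<^sup>*" for i j
    using that by induction (auto simp: const)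
  then have "cluster_constant K C (($) u)"
    using conn unfolding cluster_constant_def by blast
  \<comment> \<open>\<open>u\<close> is transverse and cluster-constant, hence orthogonal to itself.\<close>
  then have "(\<Sum>i\<in>UNIV. d $ i * (u $ i)\<^sup>2) = 0"
    using transverse_orthogonal_cluster_constant[OF cl u, of "($) u"]
    by (simp add: power2_eq_square mult.assoc)
  then have "\<forall>i\<in>UNIV. d $ i * (u $ i)\<^sup>2 = 0"
    using d by (subst (asm) sum_nonneg_eq_0_iff) (auto simp: less_imp_le)
  then show ?thesis using d by (auto simp: vec_eq_iff less_le)
qed

lemma offdiag_coupling_scale:
  "offdiag_coupling G (\<lambda>i j. t * w i j) i j = t * offdiag_coupling G w i j"
  by (simp add: offdiag_coupling_def)

text \<open>Scaling the weights by \<open>t\<close> scales the energy and leaves \<open>d\<close> stationary, so \<open>d\<close> can be fixed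
before \<open>t\<close>.\<close>

lemma scaled_weights_nonpos:
  fixes G :: "'n::finite pair_pre_digraph"
  assumes sym: "sym (parcs G)" and cl: "clustering K C"
    and w: "positive_weights G w" and \<alpha>: "\<alpha> > 0"
    and conn: "\<forall>k\<in>{1..K}. \<forall>i\<in>C k. \<forall>j\<in>C k. (i, j) \<in> (parcs G)\<^sup>*"
  obtains t d where "t > 0" and "\<And>i. d $ i > 0"
    and "nonpos_on (sym_part (diag_matrix d ** (coupling_matrix G (\<lambda>i j. t * w i j) + \<alpha> *\<^sub>R mat 1)))
              (transverse_space K C d)"
proof -
  define a where "a = offdiag_coupling G w"
  have arc: "a i j > 0 \<longleftrightarrow> (i, j) \<in> parcs G" and a0: "a i j \<ge> 0" for i j
    using w by (auto simp: a_def offdiag_coupling_def positive_weights_def less_imp_le)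
  obtain d where d: "\<And>i. d $ i > 0"
    and stationary: "\<And>j. (\<Sum>i\<in>UNIV. d $ i * a i j) = d $ j * (\<Sum>i\<in>UNIV. a j i)"
    using positive_stationary_vector[of a] a0 sym by (metis arc symD)
  define q where "q u = (1/2) * (\<Sum>i\<in>UNIV. \<Sum>j\<in>UNIV. d $ i * a i j * (u $ i - u $ j)\<^sup>2)"
    for u :: "real^'n"
  have "continuous_on UNIV q" unfolding q_def by (intro continuous_intros)
  moreover have "q (c *\<^sub>R u) = c\<^sup>2 * q u" for c u
    by (simp add: q_def sum_distrib_left right_diff_distrib[symmetric] power_mult_distrib
        mult.left_commute)
  moreover have "q u > 0" if u: "u \<in> transverse_space K C d" and "u \<noteq> 0" for u
  proof -
    obtain i j where ij: "(i, j) \<in> parcs G" "u $ i \<noteq> u $ j"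
      using transverse_constant_on_components_zero[OF cl d conn u] \<open>u \<noteq> 0\<close> by blast
    have nn: "d $ i * a i j * (u $ i - u $ j)\<^sup>2 \<ge> 0" for i j
      using d a0 by (simp add: less_imp_le)
    have "0 < d $ i * a i j * (u $ i - u $ j)\<^sup>2" using d arc ij by simp
    then have "0 < (\<Sum>j\<in>UNIV. d $ i * a i j * (u $ i - u $ j)\<^sup>2)"
      by (intro sum_pos2[of _ j "\<lambda>j. d $ i * a i j * (u $ i - u $ j)\<^sup>2"] nn) simp_all
    then have "0 < (\<Sum>i\<in>UNIV. \<Sum>j\<in>UNIV. d $ i * a i j * (u $ i - u $ j)\<^sup>2)"
      by (intro sum_pos2[of _ i "\<lambda>i. \<Sum>j\<in>UNIV. d $ i * a i j * (u $ i - u $ j)\<^sup>2"] sum_nonneg nn)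
        simp_all
    then show ?thesis by (simp add: q_def)
  qed
  ultimately obtain s where s: "s > 0"
    "\<And>u. u \<in> transverse_space K C d \<Longrightarrow> (norm u)\<^sup>2 \<le> s * q u"
    using positive_form_dominates_norm[OF subspace_transverse_space] by metis
  \<comment> \<open>\<open>\<beta>\<close> bounds \<open>(u, u)\<^sub>d\<close> by the Euclidean norm.\<close>
  define \<beta> where "\<beta> = (\<Sum>i\<in>UNIV. d $ i)"
  have \<beta>: "\<beta> > 0" unfolding \<beta>_def using d by (intro sum_pos) auto
  define t where "t = \<alpha> * \<beta> * s"
  have "u \<bullet> (sym_part (diag_matrix d ** (coupling_matrix G (\<lambda>i j. t * w i j) + \<alpha> *\<^sub>R mat 1)) *v u) \<le> 0"
    if u: "u \<in> transverse_space K C d" for u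
  proof -
    have "(\<Sum>i\<in>UNIV. d $ i * u $ i * (coupling_matrix G (\<lambda>i j. t * w i j) *v u) $ i)
        = t * (\<Sum>i\<in>UNIV. d $ i * u $ i * (\<Sum>j\<in>UNIV. a i j * (u $ j - u $ i)))"
      by (simp add: coupling_matrix_mult_vector offdiag_coupling_scale a_def sum_distrib_left
          mult.assoc mult.left_commute[of t])
    also have "\<dots> = - (t * q u)"
      unfolding stationary_energy[OF stationary] q_def by simp
    finally have energy: "(\<Sum>i\<in>UNIV. d $ i * u $ i * (coupling_matrix G (\<lambda>i j. t * w i j) *v u) $ i)
        = - (t * q u)" .
    have "(\<Sum>i\<in>UNIV. d $ i * (u $ i)\<^sup>2) \<le> (\<Sum>i\<in>UNIV. d $ i * (norm u)\<^sup>2)"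
    proof (intro sum_mono mult_left_mono)
      show "(u $ i)\<^sup>2 \<le> (norm u)\<^sup>2" for i
        using component_le_norm_cart[of u i] by (simp add: abs_le_square_iff[symmetric])
    qed (simp add: d less_imp_le)
    also have "\<dots> = \<beta> * (norm u)\<^sup>2" by (simp add: \<beta>_def sum_distrib_right)
    also have "\<dots> \<le> \<beta> * (s * q u)" using s(2)[OF u] \<beta> by simp
    finally have "\<alpha> * (\<Sum>i\<in>UNIV. d $ i * (u $ i)\<^sup>2) \<le> \<alpha> * (\<beta> * (s * q u))"
      using \<alpha> by simp
    also have "\<dots> = t * q u" by (simp add: t_def)
    finally show ?thesis unfolding weighted_form energy by simp
  qed
  moreover have "t > 0" using \<alpha> \<beta> s(1) by (simp add: t_def)
  ultimately show thesis using that[of t d] d by (simp add: nonpos_on_def)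
qed

theorem theorem5:
  fixes G :: "'n::finite pair_pre_digraph"
    and K :: nat
    and C :: "nat \<Rightarrow> 'n set"
    and \<alpha> :: real
  assumes "pair_graph G" and "pverts G = UNIV"
    and "clustering K C"
    and "\<alpha> > 0"
    and "common_intercluster_coupling G K C"
  shows "(\<exists>(w :: 'n \<Rightarrow> 'n \<Rightarrow> real) (d :: real^'n).
            positive_weights G w \<and> equal_intercluster_sums G K C w \<and>
            positive_definite (diag_matrix d) \<and>
            nonpos_on (sym_part (diag_matrix d ** (coupling_matrix G w + \<alpha> *\<^sub>R mat 1)))
              (transverse_space K C d))
         \<longleftrightarrow> (\<forall>k\<in>{1..K}. \<exists>S\<in>pre_digraph.sccs_verts (with_proj G). C k \<subseteq> S)"
  (is "?solvable \<longleftrightarrow> ?unsplit")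
proof -
  note sym = sym_arcs[OF assms(1)]
  have unsplit: "?unsplit \<longleftrightarrow> (\<forall>k\<in>{1..K}. \<forall>i\<in>C k. \<forall>j\<in>C k. (i, j) \<in> (parcs G)\<^sup>*)"
    by (simp only: within_scc_iff[OF assms(2) sym])
  show ?thesis
    unfolding unsplit
  proof (intro iffI ballI)
    fix k i j assume ?solvable and kij: "k \<in> {1..K}" "i \<in> C k" "j \<in> C k"
    then obtain w d where wd: "equal_intercluster_sums G K C w" "\<And>i. d $ i > 0"
      "nonpos_on (sym_part (diag_matrix d ** (coupling_matrix G w + \<alpha> *\<^sub>R mat 1)))
        (transverse_space K C d)"
      by (auto simp: positive_definite_diag_iff)
    have "x \<in> (parcs G)\<^sup>* `` {i} \<longleftrightarrow> y \<in> (parcs G)\<^sup>* `` {i}" if "(x, y) \<in> parcs G" for x y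
      using that symD[OF sym that] by (auto intro: rtrancl_into_rtrancl)
    from nonpos_imp_component_respects_clusters
      [OF assms(3) wd(1,2) assms(4) wd(3) this kij]
    show "(i, j) \<in> (parcs G)\<^sup>*" by simp
  next
    assume conn: "\<forall>k\<in>{1..K}. \<forall>i\<in>C k. \<forall>j\<in>C k. (i, j) \<in> (parcs G)\<^sup>*"
    obtain w where w: "positive_weights G w" "equal_intercluster_sums G K C w"
      using unit_cluster_weights[OF assms(3,5)] .
    obtain t d where td: "t > 0" "\<And>i. d $ i > 0"
      "nonpos_on (sym_part (diag_matrix d ** (coupling_matrix G (\<lambda>i j. t * w i j) + \<alpha> *\<^sub>R mat 1)))
        (transverse_space K C d)"
      using scaled_weights_nonpos[OF sym assms(3) w(1) assms(4) conn] by metis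
    have "positive_weights G (\<lambda>i j. t * w i j)"
      using w(1) td(1) by (auto simp: positive_weights_def)
    moreover have "equal_intercluster_sums G K C (\<lambda>i j. t * w i j)"
      using w(2) unfolding equal_intercluster_sums_def sum_distrib_left[symmetric] by metis
    ultimately show ?solvable using td(2,3) positive_definite_diag_iff by blast
  qed
qed

end
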